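(* Let the polynomials $E_n(q)\in\mathbb{Z}[q]$ be defined by the formal power series identity $$\sum_{n\ge0}E_n(q)x^n=1+\cfrac{x}{1-x-\cfrac{\binom22_qx^2}{1-[2]_qx-\cfrac{\binom32_qx^2}{1-[3]_qx-\cfrac{\binom42_qx^2}{1-[4]_qx-\cdots}}}},$$ i.e. $b_0+\cfrac{a_1}{b_1+\cfrac{a_2}{b_2+\cdots}}$ with $b_0=1$, $a_1=x$, $a_k=-\binom k2_qx^2$ ($k\ge2$), $b_k=1-[k]_qx$ ($k\ge1$). Then $E_0(-1)=1$ and, for $n\ge1$, $$E_n(-1)=\sum_{k=0}^{n-1}\binom{n-k-1}{k}k!,$$ equivalently $$\sum_{n\ge0}\Big(\sum_{k=0}^n\binom{n-k}{k}k!\Big)x^n=\cfrac{a_1}{b_1+\cfrac{a_2}{b_2+\cdots}}$$ with $a_1=1$, $a_{2k}=a_{2k+1}=-kx^2$ ($k\ge1$), $b_{2k}=1$ ($k\ge1$), $b_{2k+1}=1-x$ ($k\ge0$).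
   Context: $[n]_q=1+q+\cdots+q^{n-1}$, $[n]!_q=[1]_q[2]_q\cdots[n]_q$, and $\binom nk_q=\frac{[n]!_q}{[k]!_q[n-k]!_q}$ (a polynomial in $q$). $E_n(-1)$ denotes evaluation of the polynomial $E_n(q)$ at $q=-1$. A continued fraction denotes the formal power series in $x$ that is the $x$-adic limit of its convergents. (At $q=1$ the $E_n(1)$ are the Euler numbers defined by $\tan x+\sec x=\sum E_nx^n/n!$.) *)

theory Defs
  imports "HOL-Computational_Algebra.Computational_Algebra"
begin

text \<open>
  The convergents of \<open>b\<^sub>0 + a\<^sub>1 / (b\<^sub>1 + a\<^sub>2 / (b\<^sub>2 + \<dots>))\<close>:
  \<open>contfrac_tail a b k n\<close> is \<open>b\<^sub>k + a\<^sub>k\<^sub>+\<^sub>1 / (b\<^sub>k\<^sub>+\<^sub>1 + \<dots> + a\<^sub>k\<^sub>+\<^sub>n / b\<^sub>k\<^sub>+\<^sub>n)\<close>, so the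
  \<open>n\<close>-th convergent is the case \<open>k = 0\<close>.  The value \<open>a 0\<close> is never used.
\<close>

primrec contfrac_tail ::
    "(nat \<Rightarrow> 'a::field fps) \<Rightarrow> (nat \<Rightarrow> 'a fps) \<Rightarrow> nat \<Rightarrow> nat \<Rightarrow> 'a fps" where
  "contfrac_tail a b k 0 = b k"
| "contfrac_tail a b k (Suc n) = b k + a (Suc k) / contfrac_tail a b (Suc k) n"

definition contfrac_convergent ::
    "(nat \<Rightarrow> 'a::field fps) \<Rightarrow> (nat \<Rightarrow> 'a fps) \<Rightarrow> nat \<Rightarrow> 'a fps" where
  "contfrac_convergent a b n = contfrac_tail a b 0 n"

text \<open>
  Limits of formal power series are taken with respect to the library metric on \<^typ>\<open>'a fps\<close>,
  which is the \<open>x\<close>-adic one irrespective of the coefficient type.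
\<close>

definition has_contfrac ::
    "'a::field fps \<Rightarrow> (nat \<Rightarrow> 'a fps) \<Rightarrow> (nat \<Rightarrow> 'a fps) \<Rightarrow> bool" where
  "has_contfrac F a b \<longleftrightarrow> contfrac_convergent a b \<longlonglongrightarrow> F"

text \<open>The variable \<open>q\<close> is \<^term>\<open>[:0, 1:] :: int poly\<close>.\<close>

definition qint :: "nat \<Rightarrow> int poly" where
  "qint n = (\<Sum>i<n. [:0, 1:] ^ i)"

definition qfact :: "nat \<Rightarrow> int poly" where
  "qfact n = (\<Prod>i=1..n. qint i)"

text \<open>
  The \<open>div\<close> below is exact division of integer polynomials when \<open>k \<le> n\<close>, see
  \<open>qbinom_mult_qfact\<close>.
\<close>

definition qbinom :: "nat \<Rightarrow> nat \<Rightarrow> int poly" where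
  "qbinom n k = qfact n div (qfact k * qfact (n - k))"

lemma qfact_0 [simp]: "qfact 0 = 1"
  by (simp add: qfact_def)

lemma qfact_Suc: "qfact (Suc n) = qint (Suc n) * qfact n"
  by (simp add: qfact_def mult.commute)

lemma qint_add: "qint (m + n) = qint m + [:0, 1:] ^ m * qint n"
  by (induction n) (simp_all add: qint_def power_add algebra_simps)

lemma qfact_mult_dvd: "qfact k * qfact m dvd qfact (k + m)"
proof (induction "k + m" arbitrary: k m)
  case (Suc N)
  show ?case
  proof (cases "k = 0 \<or> m = 0")
    case False
    then obtain k' m' where km: "k = Suc k'" "m = Suc m'"
      by (metis not0_implies_Suc)
    have 1: "qfact k' * qfact m dvd qfact N" and 2: "qfact k * qfact m' dvd qfact N"
      using Suc.hyps(1)[of k' m] Suc.hyps(1)[of k m'] Suc.hyps(2) km by auto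
    have "qfact (k + m) = qint (k + m) * qfact N"
      by (metis Suc.hyps(2) qfact_Suc)
    also have "\<dots> = qint k * qfact N + [:0, 1:] ^ k * (qint m * qfact N)"
      by (simp only: qint_add distrib_right mult.assoc)
    finally have eq: "qfact (k + m) = qint k * qfact N + [:0, 1:] ^ k * (qint m * qfact N)" .
    have "qint k * (qfact k' * qfact m) dvd qint k * qfact N"
      using 1 by (rule mult_dvd_mono[OF dvd_refl])
    moreover have "qint m * (qfact k * qfact m') dvd qint m * qfact N"
      using 2 by (rule mult_dvd_mono[OF dvd_refl])
    moreover have "qint k * (qfact k' * qfact m) = qfact k * qfact m"
      "qint m * (qfact k * qfact m') = qfact k * qfact m"
      using km by (simp_all only: qfact_Suc mult_ac)
    ultimately show ?thesis
      unfolding eq by (metis dvd_add dvd_mult)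
  qed auto
qed auto

lemma qbinom_mult_qfact:
  assumes "k \<le> n"
  shows "qbinom n k * (qfact k * qfact (n - k)) = qfact n"
  using qfact_mult_dvd[of k "n - k"] assms by (simp add: qbinom_def)

text \<open>
  Fractions of power series need coefficients in a field, so \<open>\<int>[q]\<close> is embedded into its
  fraction field by \<^const>\<open>to_fract\<close>.
\<close>

definition euler_a :: "nat \<Rightarrow> int poly fract fps" where
  "euler_a k = (if k = 1 then fps_X else - fps_const (to_fract (qbinom k 2)) * fps_X\<^sup>2)"

definition euler_b :: "nat \<Rightarrow> int poly fract fps" where
  "euler_b k = (if k = 0 then 1 else 1 - fps_const (to_fract (qint k)) * fps_X)"

text \<open>
  The generating function with coefficients \<open>E\<^sub>n(q)\<close> is the value of the continued fraction.  That
  there is such a sequence of integer polynomials is not proved here; it is asserted together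
  with the evaluation at \<open>q = -1\<close>.
\<close>

definition q_euler :: "nat \<Rightarrow> int poly" where
  "q_euler = (THE E. has_contfrac (Abs_fps (\<lambda>n. to_fract (E n))) euler_a euler_b)"

definition aux_a :: "nat \<Rightarrow> rat fps" where
  "aux_a j = (if j = 1 then 1 else - of_nat (j div 2) * fps_X\<^sup>2)"

definition aux_b :: "nat \<Rightarrow> rat fps" where
  "aux_b j = (if j = 0 then 0 else if even j then 1 else 1 - fps_X)"

end

theory Submission
  imports Defs
begin

text \<open>
  At \<open>q = -1\<close> the integer \<open>[k]\<^sub>q\<close> becomes \<open>k mod 2\<close> and the binomial \<open>[k][k-1]/[2]\<close> becomes
  \<open>k div 2\<close>, so the first continued fraction specialises to \<open>1 + x G\<close> with \<open>G\<close> the value of the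
  second one.  Expanding \<open>G\<close> is Gauss's continued fraction for quotients of \<open>\<^sub>2F\<^sub>0\<close> series at
  \<open>y = x\<^sup>2 / (1 - x)\<close>: the series \<open>H\<^sub>j = \<^sub>2F\<^sub>0(\<lfloor>j/2\<rfloor>, \<lceil>j/2\<rceil>; y)\<close> satisfy
  \<open>H\<^sub>j\<^sub>+\<^sub>1 - H\<^sub>j = \<lceil>j/2\<rceil> y H\<^sub>j\<^sub>+\<^sub>2\<close>, so their quotients are the tails of the fraction, and
  \<open>H\<^sub>2 / (1 - x) = \<Sum>k. k! x\<^sup>2\<^sup>k / (1 - x)\<^sup>k\<^sup>+\<^sup>1\<close> has the claimed coefficients.
\<close>

subsection \<open>Continued fractions from their tails\<close>

lemma fps_tendsto_if_X_power_dvd: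
  fixes f :: "nat \<Rightarrow> 'a::comm_ring_1 fps"
  assumes "\<And>n. fps_X ^ n dvd F - f n"
  shows "f \<longlonglongrightarrow> F"
proof (rule tendsto_fpsI)
  fix n
  show "\<forall>\<^sub>F m in sequentially. f m $ n = F $ n"
    using eventually_gt_at_top[of n]
  proof eventually_elim
    case (elim m)
    obtain g where "F - f m = fps_X ^ m * g"
      using assms[of m] by (auto elim: dvdE)
    then have "(F - f m) $ n = 0"
      using elim by (simp add: fps_X_power_mult_nth)
    then show ?case by simp
  qed
qed

lemma fps_inverse_diff:
  fixes f g :: "'a::field fps"
  assumes "f $ 0 \<noteq> 0" "g $ 0 \<noteq> 0"
  shows "inverse f - inverse g = (g - f) * (inverse f * inverse g)"
proof -
  have "inverse f * f = 1" "inverse g * g = 1"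
    using assms by (simp_all add: inverse_mult_eq_1)
  then show ?thesis by algebra
qed

text \<open>Each level multiplies the error of a convergent by a factor \<open>fps_X\<close> from
  \<open>a\<close>, since nonzero constant terms make all inverses power series. The divisibility
  starts at \<open>a 2\<close> because \<open>aux_a 1\<close> is a unit.\<close>

lemma has_contfracI:
  fixes V :: "nat \<Rightarrow> 'a::field fps"
  assumes tail: "\<And>k. V k = b k + a (Suc k) * inverse (V (Suc k))"
    and unit: "\<And>k. V (Suc k) $ 0 \<noteq> 0"
    and a: "\<And>k. fps_X dvd a (Suc (Suc k))"
  shows "has_contfrac (V 0) a b"
proof -
  have a0: "a (Suc (Suc k)) $ 0 = 0" for k
    using a[of k] by (auto elim!: dvdE)
  have b0: "b (Suc k) $ 0 \<noteq> 0" for k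
    using unit[of k] a0[of k] tail[of "Suc k"] by auto
  have step: "contfrac_tail a b k (Suc n) = b k + a (Suc k) * inverse (contfrac_tail a b (Suc k) n)"
    if "contfrac_tail a b (Suc k) n $ 0 \<noteq> 0" for k n
    using that by (simp add: fps_divide_unit)
  have t0: "contfrac_tail a b (Suc k) n $ 0 \<noteq> 0" for k n
  proof (induction n arbitrary: k)
    case (Suc n)
    then show ?case using step[OF Suc.IH] a0 b0 by simp
  qed (simp add: b0)
  have diff: "V k - contfrac_tail a b k (Suc n) =
      a (Suc k) * (contfrac_tail a b (Suc k) n - V (Suc k)) *
      (inverse (V (Suc k)) * inverse (contfrac_tail a b (Suc k) n))" for k n
  proof -
    have "V k - contfrac_tail a b k (Suc n) =
        a (Suc k) * (inverse (V (Suc k)) - inverse (contfrac_tail a b (Suc k) n))"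
      by (subst tail) (simp add: step[OF t0] algebra_simps del: contfrac_tail.simps)
    then show ?thesis
      by (simp add: fps_inverse_diff[OF unit t0] mult.assoc del: contfrac_tail.simps)
  qed
  have dvd: "fps_X ^ Suc n dvd V (Suc k) - contfrac_tail a b (Suc k) n" for k n
  proof (induction n arbitrary: k)
    case 0
    show ?case using a[of k] by (subst tail) simp
  next
    case (Suc n)
    have "fps_X * fps_X ^ Suc n dvd
        a (Suc (Suc k)) * (contfrac_tail a b (Suc (Suc k)) n - V (Suc (Suc k)))"
      using a Suc.IH[of "Suc k"] by (intro mult_dvd_mono) (simp_all add: dvd_diff_commute)
    then show ?case unfolding diff by (simp del: contfrac_tail.simps)
  qed
  \<comment> \<open>\<open>a 1\<close> may contribute no factor, but the error one level down is
    already divisible by \<open>fps_X ^ Suc m\<close>.\<close>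
  have "fps_X ^ n dvd V 0 - contfrac_tail a b 0 n" for n
  proof (cases n)
    case (Suc m)
    have "fps_X ^ n dvd contfrac_tail a b 1 m - V 1"
      using dvd[of m 0] by (simp add: Suc dvd_diff_commute)
    then show ?thesis unfolding Suc diff by (simp del: contfrac_tail.simps power_Suc)
  qed simp
  then show ?thesis
    unfolding has_contfrac_def contfrac_convergent_def by (rule fps_tendsto_if_X_power_dvd)
qed

subsection \<open>Jacobi continued fractions\<close>

text \<open>The coefficients of \<open>1 / (1 - c\<^sub>k x - l\<^sub>k\<^sub>+\<^sub>1 x\<^sup>2 / (1 - c\<^sub>k\<^sub>+\<^sub>1 x - \<dots>))\<close>.\<close>

function jfrac_coeff :: "(nat \<Rightarrow> 'a::comm_ring_1) \<Rightarrow> (nat \<Rightarrow> 'a) \<Rightarrow> nat \<Rightarrow> nat \<Rightarrow> 'a" where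
  "jfrac_coeff c l k 0 = 1"
| "jfrac_coeff c l k (Suc n) = c k * jfrac_coeff c l k n +
     l (Suc k) * (\<Sum>i<n. jfrac_coeff c l (Suc k) i * jfrac_coeff c l k (n - Suc i))"
  by pat_completeness auto
termination by (relation "measure (\<lambda>(c, l, k, n). n)") auto

text \<open>Only ring operations build these coefficients. This carries them from
  \<open>int poly\<close> both into its fraction field and to q = -1.\<close>

lemma jfrac_coeff_hom:
  assumes "h 1 = 1" and "\<And>x y. h (x + y) = h x + h y" and "\<And>x y. h (x * y) = h x * h y"
  shows "h (jfrac_coeff c l k n) = jfrac_coeff (\<lambda>i. h (c i)) (\<lambda>i. h (l i)) k n"
proof (induction c l k n rule: jfrac_coeff.induct)
  case (2 c l k n)
  have "h 0 = 0"
    using assms(2)[of 0 0] by simp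
  then have sum: "h (sum f A) = (\<Sum>i\<in>A. h (f i))" for f and A :: "nat set"
    using sum_comp_morphism[of h f A] assms(2) by (simp add: o_def)
  show ?case
    using 2 by (simp add: assms(2,3) sum)
qed (simp add: assms(1))

text \<open>The recurrence is coefficient extraction from J_k (1 - c_k x - l_(k+1) x^2 J_(k+1)) =
  1.\<close>

lemma jfrac_coeff_fps:
  fixes c l :: "nat \<Rightarrow> 'a::comm_ring_1"
  defines "J \<equiv> \<lambda>k. Abs_fps (jfrac_coeff c l k)"
  shows "J k = 1 + fps_const (c k) * fps_X * J k
    + fps_const (l (Suc k)) * fps_X\<^sup>2 * (J (Suc k) * J k)"
proof (rule fps_ext)
  fix n
  consider "n = 0" | "n = 1" | m where "n = Suc (Suc m)"
    by (metis One_nat_def not0_implies_Suc)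
  then show "J k $ n = (1 + fps_const (c k) * fps_X * J k
    + fps_const (l (Suc k)) * fps_X\<^sup>2 * (J (Suc k) * J k)) $ n"
  proof cases
    case 3
    have "(J (Suc k) * J k) $ m =
        (\<Sum>i<Suc m. jfrac_coeff c l (Suc k) i * jfrac_coeff c l k (m - i))"
      by (simp add: fps_mult_nth J_def atLeast0AtMost lessThan_Suc_atMost)
    then show ?thesis
      by (simp add: 3 J_def mult.assoc fps_X_power_mult_nth)
  qed (simp_all add: J_def mult.assoc fps_X_power_mult_nth)
qed

lemma has_contfrac_jfrac:
  fixes c l :: "nat \<Rightarrow> 'a::field"
  assumes a: "\<And>k. k \<ge> 2 \<Longrightarrow> a k = - fps_const (l k) * fps_X\<^sup>2"
    and b: "\<And>k. k \<ge> 1 \<Longrightarrow> b k = 1 - fps_const (c k) * fps_X"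
  shows "has_contfrac (b 0 + a 1 * Abs_fps (jfrac_coeff c l 1)) a b"
proof -
  define J where "J = (\<lambda>k. Abs_fps (jfrac_coeff c l k))"
  \<comment> \<open>The tails are the reciprocals of the \<open>J k\<close>; level 0 is separate
    since \<open>b 0\<close> and \<open>a 1\<close> are arbitrary.\<close>
  define V where "V = (\<lambda>k. if k = 0 then b 0 + a 1 * J 1 else inverse (J k))"
  have J0: "J k $ 0 = 1" for k by (simp add: J_def)
  have "V k = b k + a (Suc k) * inverse (V (Suc k))" for k
  proof (cases "k = 0")
    case False
    have inv: "J k * inverse (J k) = 1"
      using J0 by (simp add: inverse_mult_eq_1')
    have "J k = 1 + fps_const (c k) * fps_X * J k
      + fps_const (l (Suc k)) * fps_X\<^sup>2 * (J (Suc k) * J k)"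
      unfolding J_def by (rule jfrac_coeff_fps)
    with inv have "inverse (J k) = 1 - fps_const (c k) * fps_X
      - fps_const (l (Suc k)) * fps_X\<^sup>2 * J (Suc k)"
      by algebra
    then show ?thesis
      using False J0 by (simp add: V_def a b del: fps_const_neg)
  qed (simp add: V_def J0)
  then have "has_contfrac (V 0) a b"
    by (rule has_contfracI) (simp_all add: V_def J0 a power2_eq_square)
  then show ?thesis by (simp add: V_def J_def)
qed

subsection \<open>Specialisation at \<open>q = -1\<close>\<close>

lemma poly_qint_minus_one: "poly (qint n) (- 1) = of_bool (odd n)"
  by (induction n) (simp_all add: qint_def)

text \<open>Consecutive powers pair up as q^(2i) (1 + q).\<close>

lemma qint_double: "qint (2 * m) = qint 2 * (\<Sum>i<m. [:0, 1:] ^ (2 * i))"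
proof (induction m)
  case (Suc m)
  have "qint (2 * Suc m) = qint (2 * m) + [:0, 1:] ^ (2 * m) * qint 2"
    using qint_add[of "2 * m" 2] by simp
  then show ?case
    by (simp add: Suc distrib_left mult.commute[of _ "qint 2"])
qed (simp add: qint_def)

lemma qint_nonzero:
  assumes "n > 0"
  shows "qint n \<noteq> 0"
proof -
  have "poly (qint n) 1 = int n"
    by (simp add: qint_def poly_sum)
  then show ?thesis using assms by auto
qed

lemma qfact_nonzero: "qfact n \<noteq> 0"
  by (induction n) (simp_all add: qfact_Suc qint_nonzero)

lemma qbinom_2: "qbinom (Suc (Suc n)) 2 * qint 2 = qint (Suc n) * qint (Suc (Suc n))"
proof -
  have "qfact 2 = qint 2"
    by (simp add: qfact_def numeral_2_eq_2 qint_def)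
  then have "(qbinom (Suc (Suc n)) 2 * qint 2) * qfact n =
      (qint (Suc n) * qint (Suc (Suc n))) * qfact n"
    using qbinom_mult_qfact[of 2 "Suc (Suc n)"] by (simp add: qfact_Suc mult_ac)
  then show ?thesis
    using qfact_nonzero by simp
qed

text \<open>Both sides of \<open>qbinom k 2 * [2] = [k-1] [k]\<close> vanish at \<open>-1\<close>, so \<open>[2]\<close> is cancelled first.\<close>

lemma poly_qbinom_2_minus_one:
  assumes "k \<ge> 2"
  shows "poly (qbinom k 2) (- 1) = int (k div 2)"
proof -
  obtain n where k: "k = Suc (Suc n)"
    using assms by (metis One_nat_def Suc_1 Suc_le_D Suc_le_mono)
  define m where "m = k div 2"
  \<comment> \<open>Of k - 1 and k, one is 2m and \<open>r\<close> is the other, odd one, so [r]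
    becomes 1 at -1.\<close>
  define r where "r = (if even k then Suc n else k)"
  have "qint (Suc n) * qint k = qint r * qint (2 * m)"
  proof (cases "even k")
    case True
    then have "2 * m = k" by (simp add: m_def)
    then show ?thesis using True by (simp add: r_def)
  next
    case False
    then have "2 * m = Suc n" by (simp add: m_def k)
    then show ?thesis using False by (simp add: r_def)
  qed
  then have "qbinom k 2 * qint 2 = (qint r * (\<Sum>i<m. [:0, 1:] ^ (2 * i))) * qint 2"
    using qbinom_2[of n] qint_double[of m] unfolding k by algebra
  then have "qbinom k 2 = qint r * (\<Sum>i<m. [:0, 1:] ^ (2 * i))"
    using qint_nonzero[of 2] by simp
  moreover have "odd r" by (simp add: r_def k)
  ultimately show ?thesis
    by (simp add: poly_qint_minus_one poly_sum m_def)
qed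

subsection \<open>Expansion of the second continued fraction\<close>

text \<open>The series \<open>\<Sum>k. h k * x\<^sup>2\<^sup>k / (1 - x)\<^sup>k\<^sup>+\<^sup>1\<close>.\<close>

definition binom_series :: "(nat \<Rightarrow> rat) \<Rightarrow> rat fps" where
  "binom_series h = Abs_fps (\<lambda>n. \<Sum>k=0..n. of_nat ((n - k) choose k) * h k)"

lemma binom_series_diff: "binom_series g - binom_series h = binom_series (\<lambda>k. g k - h k)"
  by (simp add: binom_series_def fps_eq_iff sum_subtractf right_diff_distrib)

lemma binom_series_scale: "binom_series (\<lambda>k. c * h k) = fps_const c * binom_series h"
  by (simp add: binom_series_def fps_eq_iff sum_distrib_left mult_ac)

text \<open>Without the term k = 0, a factor x^2 / (1 - x) comes out of every summand; on
  coefficients this is Pascal's rule.\<close>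

lemma binom_series_shift:
  assumes "h 0 = 0"
  shows "(1 - fps_X) * binom_series h = fps_X\<^sup>2 * binom_series (\<lambda>k. h (Suc k))"
proof (rule fps_ext)
  fix n
  have shift: "binom_series h $ Suc m =
      (\<Sum>k=0..m. of_nat ((m - k) choose Suc k) * h (Suc k))" for m
    unfolding binom_series_def using assms
    by (simp add: sum.atLeast0_atMost_Suc_shift del: sum.cl_ivl_Suc)
  consider "n = 0" | "n = 1" | m where "n = Suc (Suc m)"
    by (metis One_nat_def not0_implies_Suc)
  then show "((1 - fps_X) * binom_series h) $ n =
      (fps_X\<^sup>2 * binom_series (\<lambda>k. h (Suc k))) $ n"
  proof cases
    case 3
    have "binom_series h $ n =
        (\<Sum>k=0..m. of_nat (Suc (m - k) choose Suc k) * h (Suc k))"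
      unfolding 3 shift by (simp add: Suc_diff_le)
    also have "\<dots> = binom_series h $ Suc m + binom_series (\<lambda>k. h (Suc k)) $ m"
      unfolding shift by (simp add: binom_series_def distrib_right sum.distrib)
    finally show ?thesis
      by (simp add: 3 left_diff_distrib fps_X_power_mult_nth)
  qed (simp_all add: left_diff_distrib fps_X_power_mult_nth shift,
       simp_all add: binom_series_def assms)
qed

text \<open>The coefficient of y^k in the series 2F0 with parameters floor(j/2) and
  ceil(j/2).\<close>

definition hyper_coeff :: "nat \<Rightarrow> nat \<Rightarrow> rat" where
  "hyper_coeff j k =
     pochhammer (of_nat (j div 2)) k * pochhammer (of_nat (Suc j div 2)) k / fact k"

lemma hyper_coeff_contiguous:
  "hyper_coeff (Suc j) (Suc k) - hyper_coeff j (Suc k) =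
     of_nat (Suc j div 2) * hyper_coeff (Suc (Suc j)) k"
proof -
  \<comment> \<open>Passing from j to \<open>Suc j\<close> turns the parameters p, r into r, p + 1,
    so only p moves.\<close>
  define p r :: rat where "p = of_nat (j div 2)" and "r = of_nat (Suc j div 2)"
  have "hyper_coeff (Suc j) (Suc k) - hyper_coeff j (Suc k) =
      pochhammer r (Suc k) * (pochhammer (p + 1) (Suc k) - pochhammer p (Suc k)) / fact (Suc k)"
    by (simp add: hyper_coeff_def p_def r_def diff_divide_distrib right_diff_distrib add.commute
        mult.commute)
  also have "pochhammer (p + 1) (Suc k) - pochhammer p (Suc k) =
      of_nat (Suc k) * pochhammer (p + 1) k"
    unfolding pochhammer_Suc[of "p + 1"] pochhammer_rec[of p] by (simp add: algebra_simps)
  also have "pochhammer r (Suc k) * (of_nat (Suc k) * pochhammer (p + 1) k) / fact (Suc k) =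
      r * (pochhammer (p + 1) k * pochhammer (r + 1) k / fact k)"
    by (simp add: pochhammer_rec divide_simps del: of_nat_Suc)
  finally show ?thesis
    by (simp add: hyper_coeff_def p_def r_def add.commute)
qed

text \<open>The coefficients at k = 0 agree, so \<open>binom_series_shift\<close> applies to the
  difference.\<close>

lemma binom_series_contiguous:
  "(1 - fps_X) * (binom_series (hyper_coeff (Suc j)) - binom_series (hyper_coeff j)) =
     of_nat (Suc j div 2) * fps_X\<^sup>2 * binom_series (hyper_coeff (Suc (Suc j)))"
  by (simp add: binom_series_diff binom_series_shift hyper_coeff_contiguous binom_series_scale
      hyper_coeff_def[of _ 0] fps_of_nat mult.left_commute mult.assoc)

lemma binom_series_hyper_coeff_1: "(1 - fps_X) * binom_series (hyper_coeff 1) = 1"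
proof -
  have "hyper_coeff 1 k = of_bool (k = 0)" for k
    by (cases k) (simp_all add: hyper_coeff_def pochhammer_0_left)
  then have "binom_series (hyper_coeff 1) = Abs_fps (\<lambda>_. 1)"
    by (simp add: binom_series_def fps_eq_iff sum.atLeast_Suc_atMost)
  moreover have "(1 - fps_X) * inverse (1 - fps_X :: rat fps) = 1"
    by (simp add: inverse_mult_eq_1')
  ultimately show ?thesis
    by (simp add: fps_inverse_one_minus_fps_X)
qed

lemma has_contfrac_aux: "has_contfrac (binom_series fact) aux_a aux_b"
proof -
  define H where "H = (\<lambda>j. binom_series (hyper_coeff j))"
  \<comment> \<open>Splitting 1 - x as u_j u_(j+1) clears the denominator of y and leaves 1 - x at
    the odd levels, as in \<open>aux_b\<close>.\<close>
  define u :: "nat \<Rightarrow> rat fps" where "u = (\<lambda>j. if odd j then 1 - fps_X else 1)"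
  define V where "V = (\<lambda>j. if j = 0 then H 2 else u j * H j * inverse (H (Suc j)))"
  have H0: "H j $ 0 = 1" for j
    by (simp add: H_def binom_series_def hyper_coeff_def)
  have u0: "u j $ 0 = 1" for j by (simp add: u_def)
  have inv: "inverse (V (Suc j)) = inverse (u (Suc j)) * inverse (H (Suc j)) * H (Suc (Suc j))" for j
    by (simp add: V_def fps_inverse_mult H0)
  have "V j = aux_b j + aux_a (Suc j) * inverse (V (Suc j))" for j
  proof (cases "j = 0")
    case True
    have "u 1 * H 1 = 1"
      using binom_series_hyper_coeff_1 by (simp add: u_def H_def)
    then have "inverse (u 1) * inverse (H 1) = 1"
      by (simp flip: fps_inverse_mult)
    then show ?thesis
      using True unfolding inv by (simp add: V_def aux_a_def aux_b_def numeral_2_eq_2)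
  next
    case False
    have HH: "H (Suc j) * inverse (H (Suc j)) = 1" and uu: "u (Suc j) * inverse (u (Suc j)) = 1"
      using H0 u0 by (simp_all add: inverse_mult_eq_1')
    have "u j * u (Suc j) = 1 - fps_X" by (simp add: u_def)
    then have "u j * u (Suc j) * (H (Suc j) - H j) =
        of_nat (Suc j div 2) * fps_X\<^sup>2 * H (Suc (Suc j))"
      unfolding H_def by (simp only: binom_series_contiguous)
    with HH uu have "u j * H j * inverse (H (Suc j)) = u j - of_nat (Suc j div 2) * fps_X\<^sup>2 *
        (inverse (u (Suc j)) * inverse (H (Suc j)) * H (Suc (Suc j)))"
      by algebra
    moreover have "aux_b j = u j"
      using False by (simp add: aux_b_def u_def)
    ultimately show ?thesis
      using False unfolding inv by (simp add: V_def aux_a_def)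
  qed
  then have "has_contfrac (V 0) aux_a aux_b"
    by (rule has_contfracI) (simp_all add: V_def H0 u0 aux_a_def power2_eq_square)
  \<comment> \<open>Both parameters are 1 at j = 2, giving k! k! / k!.\<close>
  moreover have "hyper_coeff 2 = fact"
    by (simp add: hyper_coeff_def fun_eq_iff flip: pochhammer_fact)
  ultimately show ?thesis by (simp add: V_def H_def)
qed

section \<open>Integrality of the E_n and their values at q = -1\<close>

lemma has_contfrac_unique: "has_contfrac F a b \<Longrightarrow> has_contfrac G a b \<Longrightarrow> F = G"
  unfolding has_contfrac_def by (rule LIMSEQ_unique)

text \<open>The candidate for E_(n+1); the division-free recurrence keeps it in
  \<open>int poly\<close>.\<close>

definition euler_J :: "nat \<Rightarrow> int poly" where
  "euler_J = jfrac_coeff qint (\<lambda>k. qbinom k 2) 1"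

text \<open>At q = -1 the recurrence data become those of \<open>aux_a\<close> and
  \<open>aux_b\<close>, and a continued fraction has only one value.\<close>

lemma poly_euler_J_minus_one:
  "poly (euler_J n) (- 1) = (\<Sum>k=0..n. of_nat ((n - k) choose k) * fact k)"
proof -
  define c l :: "nat \<Rightarrow> rat"
    where "c = (\<lambda>k. of_int (poly (qint k) (- 1)))"
      and "l = (\<lambda>k. of_int (poly (qbinom k 2) (- 1)))"
  have "has_contfrac (aux_b 0 + aux_a 1 * Abs_fps (jfrac_coeff c l 1)) aux_a aux_b"
    by (rule has_contfrac_jfrac)
      (simp_all add: aux_a_def aux_b_def c_def l_def poly_qint_minus_one poly_qbinom_2_minus_one
        fps_of_nat)
  then have "Abs_fps (jfrac_coeff c l 1) = binom_series fact"
    using has_contfrac_aux has_contfrac_unique by (simp add: aux_a_def aux_b_def) blast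
  moreover have "of_int (poly (euler_J n) (- 1)) = jfrac_coeff c l 1 n"
    unfolding euler_J_def c_def l_def by (rule jfrac_coeff_hom) simp_all
  ultimately have "rat_of_int (poly (euler_J n) (- 1)) = binom_series fact $ n"
    by (metis fps_nth_Abs_fps)
  also have "\<dots> = of_int (\<Sum>k=0..n. of_nat ((n - k) choose k) * fact k)"
    by (simp add: binom_series_def)
  finally show ?thesis by (simp only: of_int_eq_iff)
qed

lemma q_euler_unique:
  assumes "has_contfrac (Abs_fps (\<lambda>n. to_fract (E n))) euler_a euler_b"
  shows "q_euler = E"
  unfolding q_euler_def
proof (rule the_equality)
  fix E'
  assume "has_contfrac (Abs_fps (\<lambda>n. to_fract (E' n))) euler_a euler_b"
  from has_contfrac_unique[OF this assms] show "E' = E"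
    by (simp add: fps_eq_iff fun_eq_iff)
qed (rule assms)

text \<open>Existence for the \<open>THE\<close> in \<open>q_euler\<close>; the numerator x at level
  1 shifts the index by one.\<close>

lemma has_contfrac_euler:
  "has_contfrac (Abs_fps (\<lambda>n. to_fract (case n of 0 \<Rightarrow> 1 | Suc m \<Rightarrow> euler_J m))) euler_a euler_b"
    (is "has_contfrac ?F _ _")
proof -
  define J where "J = jfrac_coeff (\<lambda>k. to_fract (qint k)) (\<lambda>k. to_fract (qbinom k 2)) 1"
  have "has_contfrac (euler_b 0 + euler_a 1 * Abs_fps J) euler_a euler_b"
    unfolding J_def by (rule has_contfrac_jfrac) (simp_all add: euler_a_def euler_b_def)
  moreover have "to_fract (euler_J n) = J n" for n
    unfolding euler_J_def J_def by (rule jfrac_coeff_hom) simp_all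
  then have "euler_b 0 + euler_a 1 * Abs_fps J = ?F"
    by (simp add: fps_eq_iff euler_a_def euler_b_def split: nat.split)
  ultimately show ?thesis by simp
qed

theorem theorem7p1:
  shows "has_contfrac (Abs_fps (\<lambda>n. to_fract (q_euler n))) euler_a euler_b \<and>
         poly (q_euler 0) (-1) = 1 \<and>
         (\<forall>n\<ge>1. poly (q_euler n) (-1) =
            (\<Sum>k=0..n-1. of_nat ((n - k - 1) choose k) * fact k)) \<and>
         has_contfrac (Abs_fps (\<lambda>n. \<Sum>k=0..n. of_nat ((n - k) choose k) * fact k)) aux_a aux_b"
proof -
  have E: "q_euler n = (case n of 0 \<Rightarrow> 1 | Suc m \<Rightarrow> euler_J m)" for n
    using q_euler_unique[OF has_contfrac_euler] by simp
  have "poly (q_euler n) (-1) = (\<Sum>k=0..n-1. of_nat ((n - k - 1) choose k) * fact k)"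
    if "n \<ge> 1" for n
    using that by (cases n) (simp_all add: E poly_euler_J_minus_one)
  then show ?thesis
    using has_contfrac_euler has_contfrac_aux by (simp add: E binom_series_def)
qed

end
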